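(* Let $G=K_2$ (two vertices $1,2$ joined by an edge), let $\theta$ be a weight function with $\theta_{12}=\theta(p_1,p_2)$, and let $E$ be a smooth function of $(p_1,p_2)\in(0,\infty)^2$. Then for every $p=(p_1,p_2)$ with $p_1,p_2>0$, $p_1+p_2=1$, the local Ricci curvature bound at $p$ is $$\kappa=\frac12\left(\frac{\partial\theta_{12}}{\partial p_1}-\frac{\partial\theta_{12}}{\partial p_2}\right)\left(\frac{\partial E}{\partial p_1}-\frac{\partial E}{\partial p_2}\right)+\theta_{12}\left(\frac{\partial^2E}{\partial p_1^2}-2\frac{\partial^2E}{\partial p_1\partial p_2}+\frac{\partial^2E}{\partial p_2^2}\right).$$
   Context: A weight function is $\theta:[0,\infty)^2\to[0,\infty)$, continuous, $C^\infty$ on $(0,\infty)^2$, symmetric and positive on $(0,\infty)^2$. On a graph with weights $\theta_{ij}$ ($\theta_{ij}=0$ for non-edges and $i=j$), the geodesic equation is $\dot p_i=\sum_j(f_i-f_j)\theta_{ij}$, $\dot f_i=-\frac12\sum_j(f_i-f_j)^2\partial_{p_i}\theta_{ij}+h_i$; set $\Gamma_1(p,f,f)=\sum_{i,j}\theta_{ij}(f_i-f_j)^2$ and $\Gamma_2(p,f,f)=\frac{d^2}{dt^2}E(p(t))$ along a geodesic, where $h$ is taken orthogonal to $f$ and to $\nabla E$ in the sense $\sum_{i,j}\theta_{ij}(f_i-f_j)(h_i-h_j)=0=\sum_{i,j}\theta_{ij}(\partial_iE-\partial_jE)(h_i-h_j)$ (a geodesic is constant-speed iff the first orthogonality holds).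 The local Ricci curvature bound $\kappa(p)$ is the largest number such that $\Gamma_2(p,f,f)\ge\kappa(p)\Gamma_1(p,f,f)$ for all constant-speed geodesics passing through $p$.
   Formalization: The sum over i,j in Γ₁ (and in the orthogonality conditions) is taken over unordered pairs, each edge counted once; with ordered pairs Γ₁ doubles and the stated κ would be too large by a factor 2 (e.g. θ=1, E=p₁²). *)

theory Defs
  imports "HOL-Analysis.Analysis"
begin

text \<open>Smoothness on an open set, iterating the Frechet derivative.\<close>

primrec times_differentiable_on ::
  "nat \<Rightarrow> 'a::real_normed_vector set \<Rightarrow> ('a \<Rightarrow> real) \<Rightarrow> bool" where
  "times_differentiable_on 0 S f \<longleftrightarrow> continuous_on S f"
| "times_differentiable_on (Suc n) S f \<longleftrightarrow>
     (\<forall>x\<in>S. f differentiable (at x)) \<and>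
     (\<forall>v. times_differentiable_on n S (\<lambda>x. frechet_derivative f (at x) v))"

definition smooth_on :: "'a::real_normed_vector set \<Rightarrow> ('a \<Rightarrow> real) \<Rightarrow> bool" where
  "smooth_on S f \<longleftrightarrow> (\<forall>n. times_differentiable_on n S f)"

definition partial_deriv :: "'v::finite \<Rightarrow> ((real, 'v) vec \<Rightarrow> real) \<Rightarrow> (real, 'v) vec \<Rightarrow> real" where
  "partial_deriv i F p = deriv (\<lambda>s. F (p + s *\<^sub>R axis i 1)) 0"

definition gradient :: "((real, 'v::finite) vec \<Rightarrow> real) \<Rightarrow> (real, 'v) vec \<Rightarrow> (real, 'v) vec" where
  "gradient F p = (\<chi> i. partial_deriv i F p)"

definition weight_function :: "(real \<times> real \<Rightarrow> real) \<Rightarrow> bool" where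
  "weight_function \<theta> \<longleftrightarrow>
     (\<forall>x\<ge>0. \<forall>y\<ge>0. 0 \<le> \<theta> (x, y)) \<and>
     continuous_on ({0..} \<times> {0..}) \<theta> \<and>
     smooth_on ({0<..} \<times> {0<..}) \<theta> \<and>
     (\<forall>x>0. \<forall>y>0. \<theta> (x, y) = \<theta> (y, x)) \<and>
     (\<forall>x>0. \<forall>y>0. 0 < \<theta> (x, y))"

definition edge_weight ::
  "('v::finite \<Rightarrow> 'v \<Rightarrow> bool) \<Rightarrow> (real \<times> real \<Rightarrow> real) \<Rightarrow> 'v \<Rightarrow> 'v \<Rightarrow> (real, 'v) vec \<Rightarrow> real" where
  "edge_weight adj \<theta> i j p = (if i \<noteq> j \<and> adj i j then \<theta> (p $ i, p $ j) else 0)"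

text \<open>
  In all of the following, \<open>W i j p\<close> is the weight of the pair \<open>i, j\<close> at \<open>p\<close>
  and is meant to be symmetric in \<open>i\<close> and \<open>j\<close>.

  The sum in \<open>\<Gamma>\<^sub>1\<close> runs over unordered pairs, so every edge is counted once (the linear order on
  vertices only serves to pick one orientation). This is the normalisation for which
  \<open>\<Gamma>\<^sub>1(p, f, f) / 2\<close> is the Hamiltonian of the geodesic equation:
  \<open>p\<close>' is its derivative in \<open>f\<close>, and \<open>f\<close>' (for \<open>h = 0\<close>) minus its derivative in \<open>p\<close>.
\<close>

definition Gamma1 ::
  "('v::{finite,linorder} \<Rightarrow> 'v \<Rightarrow> (real, 'v) vec \<Rightarrow> real) \<Rightarrow> (real, 'v) vec \<Rightarrow> (real, 'v) vec \<Rightarrow> (real, 'v) vec \<Rightarrow> real" where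
  "Gamma1 W p f g = (\<Sum>(i, j) | i < j. W i j p * (f $ i - f $ j) * (g $ i - g $ j))"

definition geodesic_on ::
  "('v::{finite,linorder} \<Rightarrow> 'v \<Rightarrow> (real, 'v) vec \<Rightarrow> real) \<Rightarrow> real set \<Rightarrow>
   (real \<Rightarrow> (real, 'v) vec) \<Rightarrow> (real \<Rightarrow> (real, 'v) vec) \<Rightarrow> (real \<Rightarrow> (real, 'v) vec) \<Rightarrow> bool" where
  "geodesic_on W T p f h \<longleftrightarrow>
     open T \<and> is_interval T \<and>
     (\<forall>t\<in>T. (\<forall>i. 0 < p t $ i) \<and>
        (p has_vector_derivative
           (\<chi> i. \<Sum>j\<in>UNIV. (f t $ i - f t $ j) * W i j (p t))) (at t) \<and>
        (f has_vector_derivative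
           (\<chi> i. - (1/2) * (\<Sum>j\<in>UNIV. (f t $ i - f t $ j)\<^sup>2 * partial_deriv i (W i j) (p t))
                 + h t $ i)) (at t))"

definition constant_speed_on ::
  "('v::{finite,linorder} \<Rightarrow> 'v \<Rightarrow> (real, 'v) vec \<Rightarrow> real) \<Rightarrow> real set \<Rightarrow>
   (real \<Rightarrow> (real, 'v) vec) \<Rightarrow> (real \<Rightarrow> (real, 'v) vec) \<Rightarrow> bool" where
  "constant_speed_on W T p f \<longleftrightarrow>
     (\<forall>s\<in>T. \<forall>t\<in>T. Gamma1 W (p s) (f s) (f s) = Gamma1 W (p t) (f t) (f t))"

definition orthogonal_force_on ::
  "('v::{finite,linorder} \<Rightarrow> 'v \<Rightarrow> (real, 'v) vec \<Rightarrow> real) \<Rightarrow> ((real, 'v) vec \<Rightarrow> real) \<Rightarrow> real set \<Rightarrow>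
   (real \<Rightarrow> (real, 'v) vec) \<Rightarrow> (real \<Rightarrow> (real, 'v) vec) \<Rightarrow> (real \<Rightarrow> (real, 'v) vec) \<Rightarrow> bool" where
  "orthogonal_force_on W E T p f h \<longleftrightarrow>
     (\<forall>t\<in>T. Gamma1 W (p t) (f t) (h t) = 0 \<and> Gamma1 W (p t) (gradient E (p t)) (h t) = 0)"

text \<open>\<open>\<Gamma>\<^sub>2\<close> at time \<open>t\<close> of the geodesic with position curve \<open>p\<close>.\<close>

definition Gamma2 :: "((real, 'v::finite) vec \<Rightarrow> real) \<Rightarrow> (real \<Rightarrow> (real, 'v) vec) \<Rightarrow> real \<Rightarrow> real" where
  "Gamma2 E p t = deriv (deriv (\<lambda>s. E (p s))) t"

definition ricci_lower_bound ::
  "('v::{finite,linorder} \<Rightarrow> 'v \<Rightarrow> (real, 'v) vec \<Rightarrow> real) \<Rightarrow> ((real, 'v) vec \<Rightarrow> real) \<Rightarrow>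
   (real, 'v) vec \<Rightarrow> real \<Rightarrow> bool" where
  "ricci_lower_bound W E q k \<longleftrightarrow>
     (\<forall>T p f h t. geodesic_on W T p f h \<longrightarrow> constant_speed_on W T p f \<longrightarrow>
        orthogonal_force_on W E T p f h \<longrightarrow> t \<in> T \<longrightarrow> p t = q \<longrightarrow>
        Gamma2 E p t \<ge> k * Gamma1 W q (f t) (f t))"

definition is_local_ricci_bound ::
  "('v::{finite,linorder} \<Rightarrow> 'v \<Rightarrow> (real, 'v) vec \<Rightarrow> real) \<Rightarrow> ((real, 'v) vec \<Rightarrow> real) \<Rightarrow>
   (real, 'v) vec \<Rightarrow> real \<Rightarrow> bool" where
  "is_local_ricci_bound W E q \<kappa> \<longleftrightarrow>
     ricci_lower_bound W E q \<kappa> \<and> (\<forall>k. ricci_lower_bound W E q k \<longrightarrow> k \<le> \<kappa>)"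

text \<open>The vertices of \<open>K\<^sub>2\<close> are the elements 1 and 2 of the two-element type \<open>2\<close>.\<close>

definition K2_adj :: "2 \<Rightarrow> 2 \<Rightarrow> bool" where
  "K2_adj i j \<longleftrightarrow> i \<noteq> j"

definition K2_weight :: "(real \<times> real \<Rightarrow> real) \<Rightarrow> 2 \<Rightarrow> 2 \<Rightarrow> real ^ 2 \<Rightarrow> real" where
  "K2_weight \<theta> = edge_weight K2_adj \<theta>"

end

theory Submission
  imports Defs
begin

text \<open>
  Put \<open>u = f\<^sub>1 - f\<^sub>2\<close>, \<open>w = \<theta>\<^sub>1\<^sub>2(p)\<close> and \<open>D = \<partial>\<^sub>1 - \<partial>\<^sub>2\<close>. Along a geodesic \<open>p\<^sub>1' = u w = - p\<^sub>2'\<close>, so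
  \<open>E(p)' = u w D E\<close>, and \<open>u' = - u\<^sup>2 D w / 2 + (h\<^sub>1 - h\<^sub>2)\<close>. Differentiating once more,
  \<open>\<Gamma>\<^sub>2 = u\<^sup>2 w (D w D E / 2 + w D D E) = \<kappa> \<Gamma>\<^sub>1\<close>: the two sides are equal for every geodesic. Hence
  \<open>\<kappa>\<close> is optimal as soon as one geodesic through \<open>p\<close> has \<open>\<Gamma>\<^sub>1 > 0\<close>.
\<close>

section \<open>Symmetry of second derivatives\<close>

lemma has_real_derivative_along_line:
  fixes f :: "'a::real_normed_vector \<Rightarrow> real"
  assumes "f differentiable (at (y + s *\<^sub>R u))"
  shows "((\<lambda>s. f (y + s *\<^sub>R u)) has_real_derivative
           frechet_derivative f (at (y + s *\<^sub>R u)) u) (at s)"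
proof -
  have f: "(f has_derivative frechet_derivative f (at (y + s *\<^sub>R u))) (at (y + s *\<^sub>R u))"
    using assms by (simp add: frechet_derivative_works)
  have "((\<lambda>s. y + s *\<^sub>R u) has_derivative (\<lambda>r. r *\<^sub>R u)) (at s)"
    by (auto intro!: derivative_eq_intros)
  from diff_chain_at[OF this f] show ?thesis
    by (simp add: has_field_derivative_def o_def mult_commute_abs
        linear_scale[OF has_derivative_linear[OF f]])
qed

text \<open>The mixed difference is the increment of a function of \<open>s\<close>, whose slope is
  in turn an increment in \<open>t\<close>; the mean value theorem applies to each. Swapping
  \<open>u\<close> and \<open>v\<close> leaves the difference unchanged, which makes it a tool for
  comparing the two orders of differentiation.\<close>

lemma mixed_difference_mean_value:
  fixes f :: "'a::real_normed_vector \<Rightarrow> real"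
  assumes td: "times_differentiable_on 2 S f" and r: "0 < r"
    and S: "\<And>s t. 0 \<le> s \<Longrightarrow> s \<le> r \<Longrightarrow> 0 \<le> t \<Longrightarrow> t \<le> r \<Longrightarrow> x + s *\<^sub>R u + t *\<^sub>R v \<in> S"
  obtains s t where "0 < s" "s < r" "0 < t" "t < r"
    "f (x + r *\<^sub>R u + r *\<^sub>R v) - f (x + r *\<^sub>R u) - f (x + r *\<^sub>R v) + f x =
       r * r * frechet_derivative (\<lambda>y. frechet_derivative f (at y) u) (at (x + s *\<^sub>R u + t *\<^sub>R v)) v"
proof -
  let ?D = "\<lambda>y. frechet_derivative f (at y) u"
  have f: "f differentiable (at y)" and D: "?D differentiable (at y)" if "y \<in> S" for y
    using td that by (auto simp: numeral_2_eq_2)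
  define g where "g s = f (x + r *\<^sub>R v + s *\<^sub>R u) - f (x + s *\<^sub>R u)" for s
  have "(g has_real_derivative ?D (x + r *\<^sub>R v + s *\<^sub>R u) - ?D (x + s *\<^sub>R u)) (at s)"
    if "0 \<le> s" "s \<le> r" for s
    unfolding g_def using S[of s r] S[of s 0] that r
    by (intro DERIV_diff has_real_derivative_along_line f) (simp_all add: add_ac)
  from MVT2[OF r this] obtain s where s: "0 < s" "s < r"
    and gs: "g r - g 0 = r * (?D (x + r *\<^sub>R v + s *\<^sub>R u) - ?D (x + s *\<^sub>R u))"
    by auto
  have "((\<lambda>t. ?D (x + s *\<^sub>R u + t *\<^sub>R v)) has_real_derivative
      frechet_derivative ?D (at (x + s *\<^sub>R u + t *\<^sub>R v)) v) (at t)"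
    if "0 \<le> t" "t \<le> r" for t
    using S[of s t] s that by (intro has_real_derivative_along_line D) simp_all
  from MVT2[OF r this] obtain t where t: "0 < t" "t < r"
    and Dt: "?D (x + s *\<^sub>R u + r *\<^sub>R v) - ?D (x + s *\<^sub>R u) =
      r * frechet_derivative ?D (at (x + s *\<^sub>R u + t *\<^sub>R v)) v"
    by auto
  show thesis
    using that[OF s t] gs Dt by (simp add: g_def algebra_simps)
qed

text \<open>Both orders of differentiation represent the same mixed difference, each evaluated at
  some point near \<open>x\<close>. Continuity of the second derivatives carries the equality over
  to \<open>x\<close>.\<close>

lemma frechet_derivative_mixed_commute:
  fixes f :: "'a::real_normed_vector \<Rightarrow> real"
  assumes td: "times_differentiable_on 2 S f" and S: "open S" "x \<in> S"
  shows "frechet_derivative (\<lambda>y. frechet_derivative f (at y) u) (at x) v =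
         frechet_derivative (\<lambda>y. frechet_derivative f (at y) v) (at x) u"
proof -
  define H where "H u v y = frechet_derivative (\<lambda>y. frechet_derivative f (at y) u) (at y) v" for u v y
  have cont: "isCont (H u v) x" for u v
  proof -
    have "continuous_on S (H u v)"
      using td by (simp add: numeral_2_eq_2 H_def[abs_def])
    then show ?thesis
      using S by (simp add: continuous_on_eq_continuous_at)
  qed
  have "\<bar>H u v x - H v u x\<bar> \<le> e" if e: "e > 0" for e
  proof -
    obtain d1 where d1: "d1 > 0" "\<And>y. dist y x < d1 \<Longrightarrow> dist (H u v y) (H u v x) < e/2"
      using cont[of u v] e unfolding continuous_at_eps_delta by (meson half_gt_zero)
    obtain d2 where d2: "d2 > 0" "\<And>y. dist y x < d2 \<Longrightarrow> dist (H v u y) (H v u x) < e/2"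
      using cont[of v u] e unfolding continuous_at_eps_delta by (meson half_gt_zero)
    obtain d3 where d3: "d3 > 0" "ball x d3 \<subseteq> S"
      using S openE by blast
    define d where "d = Min {d1, d2, d3}"
    have d: "d > 0" "d \<le> d1" "d \<le> d2" "d \<le> d3"
      using d1 d2 d3 by (auto simp: d_def)
    \<comment> \<open>The summand 1 keeps the denominator positive even for \<open>u = v = 0\<close>
      and makes every displacement in the parallelogram strictly shorter than
      \<open>d\<close>.\<close>
    define r where "r = d / (1 + norm u + norm v)"
    have "r > 0"
      using d by (auto simp: r_def intro!: divide_pos_pos add_pos_nonneg)
    \<comment> \<open>The condition on the norms is symmetric, so one estimate serves both
      \<open>(u, v)\<close> and \<open>(v, u)\<close>.\<close>
    have small: "dist (x + s *\<^sub>R a + t *\<^sub>R b) x < d"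
      if "0 \<le> s" "s \<le> r" "0 \<le> t" "t \<le> r" and ab: "norm a + norm b = norm u + norm v" for s t a b
    proof -
      have "norm (s *\<^sub>R a + t *\<^sub>R b) \<le> s * norm a + t * norm b"
        using that norm_triangle_ineq[of "s *\<^sub>R a" "t *\<^sub>R b"] by simp
      also have "\<dots> \<le> r * norm a + r * norm b"
        using that by (intro add_mono mult_right_mono) auto
      also have "\<dots> = r * (norm u + norm v)"
        by (simp add: ab flip: distrib_left)
      also have "\<dots> < r * (1 + norm u + norm v)"
        using \<open>r > 0\<close> by simp
      also have "\<dots> = d"
        unfolding r_def by (simp add: add_nonneg_eq_0_iff add.assoc)
      finally show ?thesis
        by (simp add: dist_norm add.assoc)
    qed
    have inS: "x + s *\<^sub>R a + t *\<^sub>R b \<in> S"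
      if "0 \<le> s" "s \<le> r" "0 \<le> t" "t \<le> r" "norm a + norm b = norm u + norm v" for s t a b
      using small[OF that] d d3 by (auto simp: subset_iff dist_commute)
    obtain s t where st: "0 < s" "s < r" "0 < t" "t < r"
      "f (x + r *\<^sub>R u + r *\<^sub>R v) - f (x + r *\<^sub>R u) - f (x + r *\<^sub>R v) + f x =
         r * r * H u v (x + s *\<^sub>R u + t *\<^sub>R v)"
      by (rule mixed_difference_mean_value[OF td \<open>r > 0\<close> inS[OF _ _ _ _ refl], folded H_def])
    have vu: "norm v + norm u = norm u + norm v" by simp
    obtain s' t' where st': "0 < s'" "s' < r" "0 < t'" "t' < r"
      "f (x + r *\<^sub>R v + r *\<^sub>R u) - f (x + r *\<^sub>R v) - f (x + r *\<^sub>R u) + f x =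
         r * r * H v u (x + s' *\<^sub>R v + t' *\<^sub>R u)"
      by (rule mixed_difference_mean_value[OF td \<open>r > 0\<close> inS[OF _ _ _ _ vu], folded H_def])
    have "r * r * H u v (x + s *\<^sub>R u + t *\<^sub>R v) = r * r * H v u (x + s' *\<^sub>R v + t' *\<^sub>R u)"
      using st(5) st'(5) by (simp add: algebra_simps)
    then have "H u v (x + s *\<^sub>R u + t *\<^sub>R v) = H v u (x + s' *\<^sub>R v + t' *\<^sub>R u)"
      using \<open>r > 0\<close> by simp
    moreover have "dist (H u v (x + s *\<^sub>R u + t *\<^sub>R v)) (H u v x) < e/2"
      using small[of s t u v] st d by (intro d1) auto
    moreover have "dist (H v u (x + s' *\<^sub>R v + t' *\<^sub>R u)) (H v u x) < e/2"
      using small[of s' t' v u] st' d by (intro d2) auto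
    ultimately show ?thesis
      unfolding dist_real_def by linarith
  qed
  then have "\<bar>H u v x - H v u x\<bar> \<le> 0"
    by (rule field_le_epsilon) simp
  then show ?thesis
    by (simp add: H_def)
qed

section \<open>Partial derivatives and the chain rule\<close>

lemma partial_deriv_eq_frechet_derivative:
  assumes "F differentiable (at q)"
  shows "partial_deriv i F q = frechet_derivative F (at q) (axis i 1)"
  unfolding partial_deriv_def
  using has_real_derivative_along_line[of F q 0 "axis i 1"] assms by (simp add: DERIV_imp_deriv)

lemma open_positive_quadrant: "open {q :: real ^ 2. 0 < q $ 1 \<and> 0 < q $ 2}"
  by (intro open_Collect_conj open_Collect_less continuous_intros)

text \<open>On \<open>S\<close> the function \<open>partial_deriv i E\<close> agrees with a Frechet
  derivative in a fixed direction; as \<open>S\<close> is open, the derivative of the latter at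
  \<open>q\<close> is also that of the former.\<close>

lemma partial_deriv_differentiable:
  assumes td: "times_differentiable_on 2 S E" and S: "open S" "q \<in> S"
  shows "partial_deriv i E differentiable (at q)"
    and "partial_deriv j (partial_deriv i E) q =
      frechet_derivative (\<lambda>y. frechet_derivative E (at y) (axis i 1)) (at q) (axis j 1)"
proof -
  let ?D = "\<lambda>y. frechet_derivative E (at y) (axis i 1)"
  have "(?D has_derivative frechet_derivative ?D (at q)) (at q)"
    using td S by (simp add: numeral_2_eq_2 flip: frechet_derivative_works)
  moreover have "?D y = partial_deriv i E y" if "y \<in> S" for y
    using td that by (simp add: partial_deriv_eq_frechet_derivative numeral_2_eq_2)
  ultimately have d: "(partial_deriv i E has_derivative frechet_derivative ?D (at q)) (at q)"
    using has_derivative_transform_within_open[OF _ S] by blast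
  then show *: "partial_deriv i E differentiable (at q)"
    by (auto simp: differentiable_def)
  show "partial_deriv j (partial_deriv i E) q = frechet_derivative ?D (at q) (axis j 1)"
    using partial_deriv_eq_frechet_derivative[OF *] frechet_derivative_at[OF d] by simp
qed

lemma partial_deriv_commute:
  assumes "times_differentiable_on 2 S E" and "open S" "q \<in> S"
  shows "partial_deriv i (partial_deriv j E) q = partial_deriv j (partial_deriv i E) q"
  using assms by (simp add: partial_deriv_differentiable frechet_derivative_mixed_commute)

text \<open>Mass only moves across the single edge, so the velocity is a multiple of
  \<open>axis 1 1 - axis 2 1\<close> and the chain rule produces only the difference of the two
  partial derivatives.\<close>

lemma has_real_derivative_along_antisymmetric_velocity:
  fixes F :: "real ^ 2 \<Rightarrow> real" and c :: "real \<Rightarrow> real ^ 2"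
  assumes F: "F differentiable (at (c t))"
    and c: "(c has_vector_derivative v) (at t)" and v: "v $ 1 = a" "v $ 2 = - a"
  shows "((\<lambda>t. F (c t)) has_real_derivative
     a * (partial_deriv 1 F (c t) - partial_deriv 2 F (c t))) (at t)"
proof -
  have F': "(F has_derivative frechet_derivative F (at (c t))) (at (c t))"
    using F by (simp add: frechet_derivative_works)
  note lin = has_derivative_linear[OF F']
  have "v = a *\<^sub>R axis 1 1 - a *\<^sub>R axis 2 1"
    using v by (simp add: vec_eq_iff forall_2 axis_def)
  then have Fv: "frechet_derivative F (at (c t)) v = a * (partial_deriv 1 F (c t) - partial_deriv 2 F (c t))"
    by (simp add: partial_deriv_eq_frechet_derivative[OF F] linear_diff[OF lin] linear_scale[OF lin]
        right_diff_distrib)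
  have "((\<lambda>t. F (c t)) has_vector_derivative frechet_derivative F (at (c t)) v) (at t)"
    using vector_derivative_diff_chain_within[of c v t UNIV F "frechet_derivative F (at (c t))"] c F'
    by (auto simp: o_def intro: has_derivative_at_withinI)
  then show ?thesis
    by (simp add: Fv has_real_derivative_iff_has_vector_derivative)
qed

section \<open>The edge weight and \<open>Gamma1\<close> on the two-vertex graph\<close>

lemma K2_weight_symmetric:
  assumes "weight_function \<theta>" "0 < q $ 1" "0 < q $ 2"
  shows "K2_weight \<theta> 2 1 q = K2_weight \<theta> 1 2 q"
  using assms by (simp add: K2_weight_def K2_adj_def edge_weight_def weight_function_def)

lemma K2_weight_pos:
  assumes "weight_function \<theta>" "0 < q $ 1" "0 < q $ 2"
  shows "0 < K2_weight \<theta> 1 2 q"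
  using assms by (simp add: K2_weight_def K2_adj_def edge_weight_def weight_function_def)

lemma K2_weight_diag [simp]: "K2_weight \<theta> i i = (\<lambda>_. 0)"
  by (simp add: K2_weight_def edge_weight_def fun_eq_iff)

lemma K2_weight_differentiable:
  assumes \<theta>: "weight_function \<theta>" and q: "0 < q $ 1" "0 < q $ 2"
  shows "K2_weight \<theta> 1 2 differentiable (at q)"
proof -
  have "times_differentiable_on (Suc 0) ({0<..} \<times> {0<..}) \<theta>"
    using \<theta> unfolding weight_function_def smooth_on_def by blast
  then have "\<theta> differentiable (at (q $ 1, q $ 2))"
    using q by simp
  moreover have "(\<lambda>q :: real ^ 2. (q $ 1, q $ 2)) differentiable (at q)"
    by (intro bounded_linear_imp_differentiable bounded_linear_Pair bounded_linear_vec_nth)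
  ultimately have "(\<lambda>q :: real ^ 2. \<theta> (q $ 1, q $ 2)) differentiable (at q)"
    using differentiable_chain_at[of "\<lambda>q :: real ^ 2. (q $ 1, q $ 2)" q \<theta>] by (simp add: o_def)
  then show ?thesis
    by (simp add: K2_weight_def K2_adj_def edge_weight_def[abs_def])
qed

text \<open>The geodesic equation at vertex 2 differentiates \<open>K2_weight \<theta> 2 1\<close>.
  Both weights agree on the positive quadrant, which is open, so their derivatives agree there
  too.\<close>

lemma partial_deriv_K2_weight_swap:
  assumes \<theta>: "weight_function \<theta>" and q: "0 < q $ 1" "0 < q $ 2"
  shows "partial_deriv i (K2_weight \<theta> 2 1) q = partial_deriv i (K2_weight \<theta> 1 2) q"
proof -
  have "(K2_weight \<theta> 1 2 has_derivative frechet_derivative (K2_weight \<theta> 1 2) (at q)) (at q)"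
    using K2_weight_differentiable[OF assms] by (simp add: frechet_derivative_works)
  then have d: "(K2_weight \<theta> 2 1 has_derivative frechet_derivative (K2_weight \<theta> 1 2) (at q)) (at q)"
    by (rule has_derivative_transform_within_open[OF _ open_positive_quadrant])
       (use q K2_weight_symmetric[OF \<theta>] in auto)
  then have "K2_weight \<theta> 2 1 differentiable (at q)"
    by (auto simp: differentiable_def)
  then show ?thesis
    using K2_weight_differentiable[OF assms] frechet_derivative_at[OF d]
    by (simp add: partial_deriv_eq_frechet_derivative)
qed

text \<open>In the library's linear order on the type \<open>2\<close>, the vertex 2 is the zero element, so 2 < 1.\<close>

lemma Gamma1_K2:
  assumes "weight_function \<theta>" "0 < q $ 1" "0 < q $ 2"
  shows "Gamma1 (K2_weight \<theta>) q f g = K2_weight \<theta> 1 2 q * (f $ 1 - f $ 2) * (g $ 1 - g $ 2)"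
proof -
  have "(0::2) < 1"
    by (simp add: less_bit0_def bit0.Rep_0 bit0.Rep_1)
  moreover have "(2::2) = 0" by simp
  ultimately have less: "(2::2) < 1" by metis
  have "i < j \<longleftrightarrow> i = 2 \<and> j = 1" for i j :: 2
    using less exhaust_2[of i] exhaust_2[of j] by (elim disjE) auto
  \<comment> \<open>The edge is counted once, as \<open>(2, 1)\<close>; reversing it flips the sign
    of both differences, so their product is the same as for \<open>(1, 2)\<close>.\<close>
  then have "{(i, j). i < (j::2)} = {(2, 1)}"
    by auto
  then show ?thesis
    using K2_weight_symmetric[OF assms] by (simp add: Gamma1_def algebra_simps)
qed

section \<open>A scalar autonomous differential equation\<close>

text \<open>Separation of variables: the solution inverts an antiderivative of \<open>1 / g\<close>.\<close>

lemma autonomous_ode_local_solution: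
  fixes g :: "real \<Rightarrow> real"
  assumes g: "continuous_on {a<..<b} g" "\<And>y. y \<in> {a<..<b} \<Longrightarrow> 0 < g y" and x0: "x0 \<in> {a<..<b}"
  obtains T x t0 where "open T" "is_interval T" "t0 \<in> T" "x t0 = x0"
    "\<And>t. t \<in> T \<Longrightarrow> x t \<in> {a<..<b}"
    "\<And>t. t \<in> T \<Longrightarrow> (x has_real_derivative g (x t)) (at t)"
proof -
  \<comment> \<open>On a compact subinterval \<open>1 / g\<close> is continuous up to the endpoints,
    so the fundamental theorem of calculus applies to \<open>G\<close>.\<close>
  obtain c d where cd: "a < c" "c < x0" "x0 < d" "d < b"
    using x0 dense by (metis greaterThanLessThan_iff)
  define S where "S = {c<..<d}"
  define G where "G y = integral {c..y} (\<lambda>y. 1 / g y)" for y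
  have sub: "S \<subseteq> {a<..<b}"
    using cd by (auto simp: S_def)
  have "continuous_on {c..d} (\<lambda>y. 1 / g y)"
  proof (intro continuous_intros ballI)
    show "continuous_on {c..d} g"
      using cd by (intro continuous_on_subset[OF g(1)]) auto
    show "g y \<noteq> 0" if "y \<in> {c..d}" for y
      using g(2)[of y] cd that by auto
  qed
  then have dG: "(G has_real_derivative 1 / g y) (at y)" if "y \<in> S" for y
    using integral_has_real_derivative[of c d "\<lambda>y. 1 / g y" y] that at_within_Icc_at[of c y d]
    by (auto simp: S_def G_def[abs_def])
  have "G y < G z" if "y \<in> S" "z \<in> S" "y < z" for y z
  proof (rule DERIV_pos_imp_increasing[OF \<open>y < z\<close>])
    fix w assume "y \<le> w" "w \<le> z"
    then have "w \<in> S"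
      using that by (auto simp: S_def)
    then show "\<exists>D. (G has_real_derivative D) (at w) \<and> 0 < D"
      using dG g(2) sub by (intro exI[of _ "1 / g w"]) auto
  qed
  then have inj: "inj_on G S"
    by (metis inj_onI linorder_neqE less_irrefl)
  have cont: "continuous_on S G"
    by (meson DERIV_isCont continuous_at_imp_continuous_on dG)
  define x where "x = the_inv_into S G"
  have x: "x (G y) = y" if "y \<in> S" for y
    using that inj by (simp add: x_def the_inv_into_f_f)
  have "open S"
    by (simp add: S_def)
  show thesis
  proof
    \<comment> \<open>The time domain is the range of \<open>G\<close>: open by invariance of
      domain, an interval by connectedness.\<close>
    show "open (G ` S)"
      by (rule invariance_of_domain[OF cont \<open>open S\<close> inj])
    show "is_interval (G ` S)"
      unfolding is_interval_connected_1
      by (rule connected_continuous_image[OF cont]) (simp add: S_def)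
    show "G x0 \<in> G ` S" "x (G x0) = x0"
      using cd x by (auto simp: S_def)
    fix t assume "t \<in> G ` S"
    then obtain y where y: "y \<in> S" "t = G y"
      by blast
    then show "x t \<in> {a<..<b}"
      using x sub by auto
    have "g y > 0"
      using g sub y by blast
    \<comment> \<open>The inverse function has the reciprocal slope of \<open>G\<close>, and this is
      the equation because \<open>x (G y) = y\<close>.\<close>
    have "(x has_derivative (*) (g y)) (at (G y))"
    proof (rule has_derivative_inverse_strong[OF \<open>open S\<close> y(1) cont x])
      show "(G has_derivative (*) (1 / g y)) (at y)"
        using dG[OF y(1)] by (simp add: has_field_derivative_def)
      show "(*) (1 / g y) \<circ> (*) (g y) = id"
        using \<open>g y > 0\<close> by (auto simp: fun_eq_iff)
    qed
    then show "(x has_real_derivative g (x t)) (at t)"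
      using x y by (simp add: has_field_derivative_def)
  qed
qed

section \<open>\<open>Gamma2\<close> along a geodesic\<close>

text \<open>Diagonal terms vanish, so each sum has one term. Symmetry of the weight makes the two
  components of the velocity opposite, and subtracting the equations for \<open>f\<close> leaves a
  scalar equation for \<open>u\<close>.\<close>

lemma geodesic_on_K2_D:
  assumes \<theta>: "weight_function \<theta>" and geo: "geodesic_on (K2_weight \<theta>) T p f h" and t: "t \<in> T"
  defines "w \<equiv> K2_weight \<theta> 1 2" and "u \<equiv> \<lambda>t. f t $ 1 - f t $ 2"
  shows "0 < p t $ 1" "0 < p t $ 2"
    and "(p has_vector_derivative (\<chi> i. if i = 1 then u t * w (p t) else - (u t * w (p t)))) (at t)"
    and "(u has_real_derivative
      - (1/2) * (u t)\<^sup>2 * (partial_deriv 1 w (p t) - partial_deriv 2 w (p t))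
      + (h t $ 1 - h t $ 2)) (at t)"
proof -
  let ?W = "K2_weight \<theta>"
  show pos: "0 < p t $ 1" "0 < p t $ 2"
    using geo t by (auto simp: geodesic_on_def)
  have "(p has_vector_derivative (\<chi> i. \<Sum>j\<in>UNIV. (f t $ i - f t $ j) * ?W i j (p t))) (at t)"
    using geo t by (auto simp: geodesic_on_def)
  moreover have "(\<chi> i. \<Sum>j\<in>UNIV. (f t $ i - f t $ j) * ?W i j (p t)) =
      (\<chi> i. if i = 1 then u t * w (p t) else - (u t * w (p t)))"
    using K2_weight_symmetric[OF \<theta> pos]
    by (simp add: vec_eq_iff forall_2 sum_2 w_def u_def algebra_simps)
  ultimately show "(p has_vector_derivative (\<chi> i. if i = 1 then u t * w (p t) else - (u t * w (p t)))) (at t)"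
    by simp
  define F where "F = (\<chi> i. - (1/2) * (\<Sum>j\<in>UNIV. (f t $ i - f t $ j)\<^sup>2 * partial_deriv i (?W i j) (p t)) + h t $ i)"
  have "(f has_vector_derivative F) (at t)"
    using geo t by (auto simp: geodesic_on_def F_def)
  then have "((\<lambda>t. f t $ i) has_vector_derivative F $ i) (at t)" for i
    by (rule bounded_linear.has_vector_derivative[OF bounded_linear_vec_nth])
  then have "((\<lambda>t. f t $ i) has_real_derivative F $ i) (at t)" for i
    by (simp add: has_real_derivative_iff_has_vector_derivative)
  then have "(u has_real_derivative F $ 1 - F $ 2) (at t)"
    unfolding u_def by (intro DERIV_diff)
  moreover have "F $ 1 - F $ 2 = - (1/2) * (u t)\<^sup>2 * (partial_deriv 1 w (p t) - partial_deriv 2 w (p t))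
      + (h t $ 1 - h t $ 2)"
    by (simp add: F_def sum_2 partial_deriv_K2_weight_swap[OF \<theta> pos] w_def u_def
        power2_commute[of "f t $ 2"] algebra_simps)
  ultimately show "(u has_real_derivative
      - (1/2) * (u t)\<^sup>2 * (partial_deriv 1 w (p t) - partial_deriv 2 w (p t))
      + (h t $ 1 - h t $ 2)) (at t)"
    by simp
qed

text \<open>
  The force enters \<open>\<Gamma>\<^sub>2\<close> only through \<open>\<theta>\<^sub>1\<^sub>2 (\<partial>\<^sub>1E - \<partial>\<^sub>2E) (h\<^sub>1 - h\<^sub>2)\<close>, which vanishes
  because \<open>h\<close> is orthogonal to the gradient of \<open>E\<close>.
\<close>

lemma Gamma2_K2:
  fixes p :: "real \<Rightarrow> real ^ 2"
  assumes \<theta>: "weight_function \<theta>"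
    and E: "times_differentiable_on 2 {q. 0 < q $ 1 \<and> 0 < q $ 2} E"
    and geo: "geodesic_on (K2_weight \<theta>) T p f h"
    and orth: "orthogonal_force_on (K2_weight \<theta>) E T p f h" and t: "t \<in> T"
  shows "Gamma2 E p t =
    (1/2 * (partial_deriv 1 (K2_weight \<theta> 1 2) (p t) - partial_deriv 2 (K2_weight \<theta> 1 2) (p t))
         * (partial_deriv 1 E (p t) - partial_deriv 2 E (p t))
     + K2_weight \<theta> 1 2 (p t) * (partial_deriv 1 (partial_deriv 1 E) (p t)
         - 2 * partial_deriv 1 (partial_deriv 2 E) (p t)
         + partial_deriv 2 (partial_deriv 2 E) (p t)))
    * Gamma1 (K2_weight \<theta>) (p t) (f t) (f t)"
proof -
  define w where "w = K2_weight \<theta> 1 2"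
  define u where "u t = f t $ 1 - f t $ 2" for t
  define e where "e q = partial_deriv 1 E q - partial_deriv 2 E q" for q
  define Dw where "Dw = partial_deriv 1 w (p t) - partial_deriv 2 w (p t)"
  define De where "De = partial_deriv 1 e (p t) - partial_deriv 2 e (p t)"
  define H where "H = h t $ 1 - h t $ 2"
  note D = geodesic_on_K2_D[OF \<theta> geo, folded w_def u_def]
  have diffE: "E differentiable (at q)" and diff_e: "partial_deriv i E differentiable (at q)"
    if "0 < q $ 1" "0 < q $ 2" for q i
    using that E partial_deriv_differentiable(1)[OF E open_positive_quadrant]
    by (auto simp: numeral_2_eq_2)
  have deriv1: "((\<lambda>s. E (p s)) has_real_derivative u s * w (p s) * e (p s)) (at s)" if "s \<in> T" for s
    unfolding e_def using D[OF that] diffE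
    by (intro has_real_derivative_along_antisymmetric_velocity) auto
  note pos = D(1,2)[OF t]
  have w': "((\<lambda>s. w (p s)) has_real_derivative u t * w (p t) * Dw) (at t)"
    unfolding Dw_def using D[OF t] K2_weight_differentiable[OF \<theta> pos]
    by (intro has_real_derivative_along_antisymmetric_velocity) (auto simp: w_def)
  have e': "((\<lambda>s. e (p s)) has_real_derivative u t * w (p t) * De) (at t)"
    unfolding De_def using D[OF t] diff_e[OF pos]
    by (intro has_real_derivative_along_antisymmetric_velocity) (auto simp: e_def[abs_def])
  \<comment> \<open>Expanding the difference operator twice gives the mixed partial derivative in
    both orders; their equality yields the factor 2.\<close>
  have De: "De = partial_deriv 1 (partial_deriv 1 E) (p t) - 2 * partial_deriv 1 (partial_deriv 2 E) (p t)
      + partial_deriv 2 (partial_deriv 2 E) (p t)"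
  proof -
    have "partial_deriv i e (p t) = partial_deriv i (partial_deriv 1 E) (p t)
        - partial_deriv i (partial_deriv 2 E) (p t)" for i
    proof -
      have "(e has_derivative (\<lambda>v. frechet_derivative (partial_deriv 1 E) (at (p t)) v -
          frechet_derivative (partial_deriv 2 E) (at (p t)) v)) (at (p t))"
        unfolding e_def[abs_def] using diff_e[OF pos]
        by (intro has_derivative_diff) (simp_all add: frechet_derivative_works)
      then show ?thesis
        using diff_e[OF pos] frechet_derivative_at[of e] differentiableI[of e]
        by (metis (no_types, lifting) partial_deriv_eq_frechet_derivative)
    qed
    then show ?thesis
      using partial_deriv_commute[OF E open_positive_quadrant, of "p t" 1 2] pos
      by (simp add: De_def)
  qed
  have u': "(u has_real_derivative - (1/2) * (u t)\<^sup>2 * Dw + H) (at t)"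
    using D(4)[OF t] by (simp add: Dw_def H_def)
  have "w (p t) * e (p t) * H = 0"
    using orth t Gamma1_K2[OF \<theta> pos, of "gradient E (p t)" "h t"]
    by (simp add: orthogonal_force_on_def gradient_def e_def H_def w_def)
  then have H: "H * w (p t) * e (p t) = 0"
    by (simp add: ac_simps)
  have T: "open T"
    using geo by (simp add: geodesic_on_def)
  have "((\<lambda>s. u s * w (p s) * e (p s)) has_real_derivative
      (u t)\<^sup>2 * w (p t) * (1/2 * Dw * e (p t) + w (p t) * De) + H * w (p t) * e (p t)) (at t)"
    by (rule derivative_eq_intros u' w' e' refl)+ (simp add: algebra_simps power2_eq_square)
  then have "((\<lambda>s. u s * w (p s) * e (p s)) has_real_derivative
      (u t)\<^sup>2 * w (p t) * (1/2 * Dw * e (p t) + w (p t) * De)) (at t)"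
    using H by simp
  \<comment> \<open>\<open>Gamma2\<close> differentiates \<open>deriv\<close>, so the formula for
    the first derivative must hold on a neighbourhood of \<open>t\<close>; the open set
    \<open>T\<close> is one.\<close>
  then have "(deriv (\<lambda>s. E (p s)) has_real_derivative
      (u t)\<^sup>2 * w (p t) * (1/2 * Dw * e (p t) + w (p t) * De)) (at t)"
    by (rule has_field_derivative_transform_within_open[OF _ T t]) (simp add: DERIV_imp_deriv[OF deriv1])
  then have "Gamma2 E p t = (u t)\<^sup>2 * w (p t) * (1/2 * Dw * e (p t) + w (p t) * De)"
    unfolding Gamma2_def by (rule DERIV_imp_deriv)
  also have "(u t)\<^sup>2 * w (p t) = Gamma1 (K2_weight \<theta>) (p t) (f t) (f t)"
    by (simp add: Gamma1_K2[OF \<theta> pos] w_def u_def power2_eq_square ac_simps)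
  finally show ?thesis
    by (simp add: De Dw_def e_def w_def ac_simps)
qed

section \<open>Existence of a unit-speed geodesic\<close>

text \<open>
  With \<open>\<Gamma>\<^sub>1 = 1\<close> the equation for \<open>p\<^sub>1\<close> decouples to \<open>p\<^sub>1' = sqrt \<theta>\<^sub>1\<^sub>2(p)\<close>, and \<open>f\<^sub>1 - f\<^sub>2 = 1 / sqrt \<theta>\<^sub>1\<^sub>2(p)\<close>.
  Only this difference matters, so \<open>f\<^sub>2 = 0\<close> is arranged by a force with \<open>h\<^sub>1 = h\<^sub>2\<close>.
\<close>

lemma K2_unit_speed_geodesic_exists:
  fixes q :: "real ^ 2"
  assumes \<theta>: "weight_function \<theta>" and q: "0 < q $ 1" "0 < q $ 2" "q $ 1 + q $ 2 = 1"
  obtains T p f h t where "geodesic_on (K2_weight \<theta>) T p f h"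
    "orthogonal_force_on (K2_weight \<theta>) E T p f h" "t \<in> T" "p t = q"
    "\<And>s. s \<in> T \<Longrightarrow> Gamma1 (K2_weight \<theta>) (p s) (f s) (f s) = 1"
proof -
  define w where "w = K2_weight \<theta> 1 2"
  \<comment> \<open>Total mass is conserved, so the curve stays on the line through \<open>q\<close>
    where the coordinates sum to 1; there \<open>c (q $ 1) = q\<close>.\<close>
  define c :: "real \<Rightarrow> real ^ 2" where "c y = (\<chi> i. if i = 1 then y else 1 - y)" for y
  define Dw where "Dw y = partial_deriv 1 w (c y) - partial_deriv 2 w (c y)" for y
  have c_pos: "0 < c y $ 1" "0 < c y $ 2" if "y \<in> {0<..<1}" for y
    using that by (auto simp: c_def)
  have w_pos: "0 < w (c y)" if "y \<in> {0<..<1}" for y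
    using K2_weight_pos[OF \<theta> c_pos[OF that]] by (simp add: w_def)
  have c': "(c has_vector_derivative (\<chi> i. if i = 1 then 1 else - 1)) (at y)" for y
  proof -
    have "c = (\<lambda>y. axis 2 1 + y *\<^sub>R (\<chi> i. if i = 1 then 1 else - 1))"
      by (auto simp: fun_eq_iff c_def vec_eq_iff forall_2 axis_def)
    moreover have "((\<lambda>y. axis 2 1 + y *\<^sub>R (\<chi> i. if i = 1 then 1 else - 1)) has_vector_derivative
        ((\<chi> i. if i = 1 then 1 else - 1) :: real ^ 2)) (at y)"
      by (auto intro!: derivative_eq_intros)
    ultimately show ?thesis by simp
  qed
  have wc': "((\<lambda>y. w (c y)) has_real_derivative Dw y) (at y)" if "y \<in> {0<..<1}" for y
    using has_real_derivative_along_antisymmetric_velocity[OF _ c', of w y 1]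
      K2_weight_differentiable[OF \<theta> c_pos[OF that]] by (simp add: w_def Dw_def)
  define g where "g y = sqrt (w (c y))" for y
  have g_pos: "0 < g y" and g_sq: "g y * g y = w (c y)" if "y \<in> {0<..<1}" for y
    using w_pos[OF that] by (simp_all add: g_def)
  have g': "(g has_real_derivative Dw y / (2 * g y)) (at y)" if "y \<in> {0<..<1}" for y
    unfolding g_def using w_pos[OF that]
    by (auto intro!: derivative_eq_intros wc'[OF that] simp: field_simps)
  have "continuous_on {0<..<1} g"
    by (meson DERIV_isCont continuous_at_imp_continuous_on g')
  moreover have "q $ 1 \<in> {0<..<1}"
    using q by auto
  ultimately obtain T x t0 where T: "open T" "is_interval T" "t0 \<in> T" "x t0 = q $ 1"
    and x: "\<And>t. t \<in> T \<Longrightarrow> x t \<in> {0<..<1}"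
    and x': "\<And>t. t \<in> T \<Longrightarrow> (x has_real_derivative g (x t)) (at t)"
    using autonomous_ode_local_solution[of 0 1 g "q $ 1"] g_pos by metis
  define p where "p t = c (x t)" for t
  define f :: "real \<Rightarrow> real ^ 2" where "f t = (1 / g (x t)) *\<^sub>R axis 1 1" for t
  \<comment> \<open>The value cancels the quadratic term at vertex 2, which keeps
    \<open>f t $ 2\<close> at 0. It does not depend on \<open>i\<close>.\<close>
  define h :: "real \<Rightarrow> real ^ 2" where
    "h t = (\<chi> i. 1/2 * (1 / g (x t))\<^sup>2 * partial_deriv 2 w (p t))" for t
  have f12: "f t $ 1 = 1 / g (x t)" "f t $ 2 = 0" for t
    by (simp_all add: f_def axis_def)
  note pos = c_pos[OF x, folded p_def]
  show thesis
  proof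
    show "geodesic_on (K2_weight \<theta>) T p f h"
      unfolding geodesic_on_def
    proof (intro conjI ballI)
      fix t assume t: "t \<in> T"
      note gt = g_pos[OF x[OF t]] g_sq[OF x[OF t]]
      show "\<forall>i. 0 < p t $ i"
        using pos[OF t] by (simp add: forall_2)
      have "(p has_vector_derivative g (x t) *\<^sub>R (\<chi> i. if i = 1 then 1 else - 1)) (at t)"
        unfolding p_def
        using vector_diff_chain_at[OF x'[OF t, unfolded has_real_derivative_iff_has_vector_derivative] c']
        by (simp add: o_def)
      \<comment> \<open>The flux across the edge is \<open>(1 / g) * w = g\<close>, since
        \<open>g\<close> squares to \<open>w\<close> along \<open>c\<close>.\<close>
      also have "g (x t) *\<^sub>R (\<chi> i. if i = 1 then 1 else - 1) =
          (\<chi> i. \<Sum>j\<in>UNIV. (f t $ i - f t $ j) * K2_weight \<theta> i j (p t))"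
        using gt K2_weight_symmetric[OF \<theta> pos[OF t]]
        by (simp add: vec_eq_iff forall_2 sum_2 f12 p_def w_def field_simps)
      finally show "(p has_vector_derivative
          (\<chi> i. \<Sum>j\<in>UNIV. (f t $ i - f t $ j) * K2_weight \<theta> i j (p t))) (at t)" .
      have "((\<lambda>t. g (x t)) has_real_derivative Dw (x t) / (2 * g (x t)) * g (x t)) (at t)"
        by (rule DERIV_chain2[OF g'[OF x[OF t]] x'[OF t]])
      then have "((\<lambda>t. 1 / g (x t)) has_real_derivative - (1/2) * (1 / g (x t))\<^sup>2 * Dw (x t)) (at t)"
        using gt by (auto intro!: derivative_eq_intros simp: power2_eq_square field_simps)
      then have "(f has_vector_derivative (- (1/2) * (1 / g (x t))\<^sup>2 * Dw (x t)) *\<^sub>R axis 1 1) (at t)"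
        unfolding f_def has_real_derivative_iff_has_vector_derivative
        by (rule bounded_linear.has_vector_derivative[OF bounded_linear_scaleR_left])
      also have "(- (1/2) * (1 / g (x t))\<^sup>2 * Dw (x t)) *\<^sub>R axis 1 1 =
          (\<chi> i. - (1/2) * (\<Sum>j\<in>UNIV. (f t $ i - f t $ j)\<^sup>2 * partial_deriv i (K2_weight \<theta> i j) (p t))
            + h t $ i)"
        by (simp add: vec_eq_iff forall_2 sum_2 f12 axis_def h_def Dw_def w_def
            partial_deriv_K2_weight_swap[OF \<theta> pos[OF t]] flip: p_def)
          (use gt in \<open>simp add: field_simps\<close>)
      finally show "(f has_vector_derivative
          (\<chi> i. - (1/2) * (\<Sum>j\<in>UNIV. (f t $ i - f t $ j)\<^sup>2 * partial_deriv i (K2_weight \<theta> i j) (p t))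
            + h t $ i)) (at t)" .
    qed (use T in auto)
    \<comment> \<open>Equal components of \<open>h\<close> annihilate \<open>Gamma1\<close> against
      any vector, in particular against \<open>f\<close> and the gradient of
      \<open>E\<close>.\<close>
    show "orthogonal_force_on (K2_weight \<theta>) E T p f h"
      using pos by (simp add: orthogonal_force_on_def Gamma1_K2[OF \<theta>] h_def)
    show "t0 \<in> T" by fact
    show "p t0 = q"
      using q T by (simp add: p_def c_def vec_eq_iff forall_2)
    fix s assume s: "s \<in> T"
    show "Gamma1 (K2_weight \<theta>) (p s) (f s) (f s) = 1"
      using w_pos[OF x[OF s]] g_pos[OF x[OF s]] g_sq[OF x[OF s]]
      by (simp add: Gamma1_K2[OF \<theta> pos[OF s]] f12 flip: w_def) (simp add: p_def field_simps)
  qed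
qed

section \<open>Validity and optimality of the bound\<close>

theorem mainTheorem5:
  fixes \<theta> :: "real \<times> real \<Rightarrow> real"
    and E :: "real ^ 2 \<Rightarrow> real"
    and p :: "real ^ 2"
  assumes "weight_function \<theta>"
    and "smooth_on {q. 0 < q $ 1 \<and> 0 < q $ 2} E"
    and "0 < p $ 1" and "0 < p $ 2" and "p $ 1 + p $ 2 = 1"
  shows "is_local_ricci_bound (K2_weight \<theta>) E p
    (1/2 * (partial_deriv 1 (K2_weight \<theta> 1 2) p - partial_deriv 2 (K2_weight \<theta> 1 2) p)
         * (partial_deriv 1 E p - partial_deriv 2 E p)
     + K2_weight \<theta> 1 2 p * (partial_deriv 1 (partial_deriv 1 E) p
         - 2 * partial_deriv 1 (partial_deriv 2 E) p
         + partial_deriv 2 (partial_deriv 2 E) p))"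
    (is "is_local_ricci_bound ?W E p ?\<kappa>")
proof -
  have E: "times_differentiable_on 2 {q. 0 < q $ 1 \<and> 0 < q $ 2} E"
    using assms(2) unfolding smooth_on_def by blast
  note \<Gamma>2 = Gamma2_K2[OF assms(1) E]
  show ?thesis
    unfolding is_local_ricci_bound_def
  proof (intro conjI allI impI)
    show "ricci_lower_bound ?W E p ?\<kappa>"
      unfolding ricci_lower_bound_def using \<Gamma>2 by (metis order_refl)
    fix k assume k: "ricci_lower_bound ?W E p k"
    obtain T c f h t where geo: "geodesic_on ?W T c f h"
      and orth: "orthogonal_force_on ?W E T c f h" and t: "t \<in> T" "c t = p"
      and unit: "\<And>s. s \<in> T \<Longrightarrow> Gamma1 ?W (c s) (f s) (f s) = 1"
      using K2_unit_speed_geodesic_exists[OF assms(1,3,4,5)] by metis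
    have "constant_speed_on ?W T c f"
      using unit by (simp add: constant_speed_on_def)
    with k geo orth t have "k * Gamma1 ?W p (f t) (f t) \<le> Gamma2 E c t"
      unfolding ricci_lower_bound_def by blast
    \<comment> \<open>Since \<open>Gamma1\<close> is 1 on this geodesic, \<open>Gamma2\<close> is
      exactly the claimed constant, which therefore dominates \<open>k\<close>.\<close>
    then show "k \<le> ?\<kappa>"
      using \<Gamma>2[OF geo orth t(1)] unit[OF t(1)] t(2) by simp
  qed
qed

end
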